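(* Let $(M,S,\eta)$ be a factorable monoid. Then the quadratic normalisation $(S,N'_\varphi)$ corresponding to $\eta$ is of class $(5,4)$.
   Context: Notation. $M$ is a monoid with multiplication $\mu:M^2\to M$, $S\subseteq M$ is a generating subset with $1\in S$, and $S_+=S\setminus\{1\}$. $S^*$ is the free monoid over $S$; its elements are words $(s_1,\ldots,s_n)=s_1|\cdots|s_n$; $|w|$ is the length of a word. For $f\in M$, $|f|$ is the minimal length of an $S$-word representing $f$ (so $|1|=0$). For a set $A$ and $F:A^2\to A^2$, $F_i$ applies $F$ to the entries at positions $i,i+1$ of a word over $A$ (counted from the left). Compositions are read with the rightmost map applied first. Factorability. A factorisation map for $(M,S)$ is a map $\eta=(\eta',\overline{\eta}):M\to M^2$ with $\eta(1)=(1,1)$ and, for every $f\ne1$: $\eta'(f)\in S_+$, $\eta'(f)\cdot\overline{\eta}(f)=f$, $|f|=|\eta'(f)|+|\overline{\eta}(f)|$. It is a factorability structure, and $(M,S,\eta)$ is a factorable monoid, if, with $F=\eta\circ\mu$, for every triple in $M^3$ either $F_1F_2F_1F_2$, $F_2F_1F_2$, $F_2F_1F_2F_1$ take the same value on it or each of these three maps strictly reduces the sum of the lengths of the entries. $\varphi$ denotes the restriction of $\eta\mu$ to $S^2$; it takes values in $S^2$. The maps $N_\varphi$ and $N'_\varphi$. For $w\in S^*$ put $T_\varphi(w)=\varphi_{|w|-1}\cdots\varphi_1(w)$ ($T_\varphi(w)=w$ if $|w|=1$). $N_\varphi:S^*\to S^*$ is defined recursively: $N_\varphi$ of the empty word is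 empty; $N_\varphi$ of a word containing the letter $1$ equals $N_\varphi$ of the word with $1$ removed; for $s_1,\ldots,s_n\in S_+$, putting $v=T_\varphi(s_1|N_\varphi(s_2,\ldots,s_n))$, $N_\varphi(s_1,\ldots,s_n)=v$ if $v$ contains no $1$, and $=N_\varphi(v)$ otherwise. Then $N'_\varphi(w)=N_\varphi(w)|1^m$ with $m=|w|-|N_\varphi(w)|$. The pair $(S,N'_\varphi)$ is a quadratic normalisation, called the quadratic normalisation corresponding to $\eta$. Normalisation. A normalisation is a pair $(A,N)$ with $N:A^*\to A^*$ length-preserving, identity on one-letter words, and $N(u|v|w)=N(u|N(v)|w)$ for all words $u,v,w$; $w$ is $N$-normal if $N(w)=w$; $\overline{N}$ is the restriction of $N$ to length-two words. $(A,N)$ is quadratic if a word is $N$-normal iff all its length-two factors are, and for each word $w$ there is a finite sequence of positions $(i_1,\ldots,i_k)$ with $N(w)=\overline{N}_{i_k}\cdots\overline{N}_{i_1}(w)$. Class. A quadratic normalisation $(A,N)$ is of left-class $m$ (resp. right-class $n$) if for every length-three word $w$, $N(w)$ is obtained from $w$ by applying alternately $\overline{N}_1,\overline{N}_2,\overline{N}_1,\ldots$ ($m$ maps in total, $\overline{N}_1$ first) (resp. $\overline{N}_2,\overline{N}_1,\overline{N}_2,\ldots$, $n$ maps in total, $\overline{N}_2$ first). It is of class $(m,n)$ if it is of left-class $m$ and right-class $n$. *)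

theory Defs
  imports Main
begin

definition generating_set :: "'a::monoid_mult set \<Rightarrow> bool" where
  "generating_set S \<longleftrightarrow> (\<forall>f. \<exists>w\<in>lists S. prod_list w = f)"

definition word_length :: "'a::monoid_mult set \<Rightarrow> 'a \<Rightarrow> nat" where
  "word_length S f = (LEAST n. \<exists>w\<in>lists S. length w = n \<and> prod_list w = f)"

text \<open>
  Positions in words are counted from 1. \<open>apply_at F i\<close> is the map written $F_i$;
  it leaves a word unchanged if positions $i$, $i+1$ do not both exist.
\<close>

definition apply_at :: "('a \<times> 'a \<Rightarrow> 'a \<times> 'a) \<Rightarrow> nat \<Rightarrow> 'a list \<Rightarrow> 'a list" where
  "apply_at F i w =
     (if 1 \<le> i \<and> i < length w
      then (let (a, b) = F (w ! (i - 1), w ! i) in w[i - 1 := a, i := b])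
      else w)"

lemma length_apply_at [simp]: "length (apply_at F i w) = length w"
  by (simp add: apply_at_def split: prod.split)

definition factorisation_map ::
    "'a::monoid_mult set \<Rightarrow> ('a \<Rightarrow> 'a \<times> 'a) \<Rightarrow> bool" where
  "factorisation_map S \<eta> \<longleftrightarrow>
     \<eta> 1 = (1, 1) \<and>
     (\<forall>f. f \<noteq> 1 \<longrightarrow>
        fst (\<eta> f) \<in> S - {1} \<and>
        fst (\<eta> f) * snd (\<eta> f) = f \<and>
        word_length S f = word_length S (fst (\<eta> f)) + word_length S (snd (\<eta> f)))"

text \<open>
  The map $\eta\circ\mu$ on $M^2$. The map $\varphi$ is its restriction to $S^2$, which
  takes values in $S^2$ if $\eta$ is a factorisation map; the restriction is realised
  by only using it on words over $S$.
\<close>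

definition factor_prod :: "('a::monoid_mult \<Rightarrow> 'a \<times> 'a) \<Rightarrow> 'a \<times> 'a \<Rightarrow> 'a \<times> 'a" where
  "factor_prod \<eta> = (\<lambda>(a, b). \<eta> (a * b))"

definition total_length :: "'a::monoid_mult set \<Rightarrow> 'a list \<Rightarrow> nat" where
  "total_length S w = sum_list (map (word_length S) w)"

definition factorability_structure ::
    "'a::monoid_mult set \<Rightarrow> ('a \<Rightarrow> 'a \<times> 'a) \<Rightarrow> bool" where
  "factorability_structure S \<eta> \<longleftrightarrow>
     factorisation_map S \<eta> \<and>
     (let F1 = apply_at (factor_prod \<eta>) 1; F2 = apply_at (factor_prod \<eta>) 2 in
      \<forall>t. length t = 3 \<longrightarrow>
        (F1 (F2 (F1 (F2 t))) = F2 (F1 (F2 t)) \<and>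
         F2 (F1 (F2 t)) = F2 (F1 (F2 (F1 t)))) \<or>
        (total_length S (F1 (F2 (F1 (F2 t)))) < total_length S t \<and>
         total_length S (F2 (F1 (F2 t))) < total_length S t \<and>
         total_length S (F2 (F1 (F2 (F1 t)))) < total_length S t))"

definition factorable_monoid ::
    "'a::monoid_mult set \<Rightarrow> ('a \<Rightarrow> 'a \<times> 'a) \<Rightarrow> bool" where
  "factorable_monoid S \<eta> \<longleftrightarrow>
     generating_set S \<and> 1 \<in> S \<and> factorability_structure S \<eta>"

text \<open>\<open>fold\<close> applies the map at position 1 first.\<close>

definition sweep :: "('a \<times> 'a \<Rightarrow> 'a \<times> 'a) \<Rightarrow> 'a list \<Rightarrow> 'a list" where
  "sweep \<phi> w = fold (apply_at \<phi>) [1..<length w] w"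

lemma length_fold_apply_at [simp]: "length (fold (apply_at F) is w) = length w"
  by (induction "is" arbitrary: w) simp_all

lemma length_sweep [simp]: "length (sweep \<phi> w) = length w"
  by (simp add: sweep_def)

text \<open>The recursion terminates for every $\varphi$, since it never lengthens a word.\<close>

function N_phi :: "('a::one \<times> 'a \<Rightarrow> 'a \<times> 'a) \<Rightarrow> 'a list \<Rightarrow> 'a list" where
  "N_phi \<phi> [] = []"
| "N_phi \<phi> (s # w) =
     (if 1 \<in> set (s # w) then N_phi \<phi> (removeAll 1 (s # w))
      else let v = sweep \<phi> (s # N_phi \<phi> w)
           in if 1 \<in> set v then N_phi \<phi> v else v)"
  by pat_completeness auto

lemma length_N_phi_dom: "N_phi_dom (\<phi>, w) \<Longrightarrow> length (N_phi \<phi> w) \<le> length w"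
proof (induction \<phi> w rule: N_phi.pinduct)
  case (1 \<phi>)
  then show ?case by (simp add: N_phi.psimps)
next
  case (2 \<phi> s w)
  show ?case
  proof (cases "1 \<in> set (s # w)")
    case True
    then have "length (N_phi \<phi> (s # w)) \<le> length (removeAll 1 (s # w))"
      using 2(1) 2(2)[OF True] by (simp add: N_phi.psimps del: removeAll.simps)
    also have "\<dots> \<le> length (s # w)"
      by (rule length_removeAll_less_eq)
    finally show ?thesis .
  next
    case False
    define v where "v = sweep \<phi> (s # N_phi \<phi> w)"
    have "length v \<le> length (s # w)"
      using 2(3)[OF False] by (simp add: v_def)
    moreover have "N_phi \<phi> (s # w) = (if 1 \<in> set v then N_phi \<phi> v else v)"
      using False 2(1) by (simp add: N_phi.psimps v_def Let_def)
    moreover have "1 \<in> set v \<Longrightarrow> length (N_phi \<phi> v) \<le> length v"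
      using 2(4)[OF False v_def] by simp
    ultimately show ?thesis by (auto split: if_splits)
  qed
qed

termination
proof (relation "measures [\<lambda>(\<phi>, w). length (removeAll 1 w), \<lambda>(\<phi>, w). length w]", goal_cases)
  case 1
  then show ?case by simp
next
  case (2 \<phi> s w)
  then show ?case
    using length_removeAll_less[of 1 "s # w"] by (simp del: removeAll.simps)
next
  case (3 \<phi> s w)
  then show ?case by (auto simp: removeAll_id)
next
  case (4 \<phi> s w v)
  then have "length v \<le> length (s # w)"
    using length_N_phi_dom[of \<phi> w] by simp
  moreover have "length (removeAll 1 v) < length v"
    using 4 by (intro length_removeAll_less) simp
  moreover have "removeAll 1 (s # w) = s # w"
    using 4 by (intro removeAll_id) simp
  ultimately show ?case by (simp del: removeAll.simps)
qed

definition N'_phi :: "('a::one \<times> 'a \<Rightarrow> 'a \<times> 'a) \<Rightarrow> 'a list \<Rightarrow> 'a list" where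
  "N'_phi \<phi> w = N_phi \<phi> w @ replicate (length w - length (N_phi \<phi> w)) 1"

definition normalisation :: "'a set \<Rightarrow> ('a list \<Rightarrow> 'a list) \<Rightarrow> bool" where
  "normalisation A N \<longleftrightarrow>
     (\<forall>w\<in>lists A. N w \<in> lists A \<and> length (N w) = length w) \<and>
     (\<forall>a\<in>A. N [a] = [a]) \<and>
     (\<forall>u\<in>lists A. \<forall>v\<in>lists A. \<forall>w\<in>lists A. N (u @ v @ w) = N (u @ N v @ w))"

definition normal_word :: "('a list \<Rightarrow> 'a list) \<Rightarrow> 'a list \<Rightarrow> bool" where
  "normal_word N w \<longleftrightarrow> N w = w"

text \<open>The restriction of $N$ to length-two words, as a map on pairs.\<close>

definition N_bar :: "('a list \<Rightarrow> 'a list) \<Rightarrow> 'a \<times> 'a \<Rightarrow> 'a \<times> 'a" where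
  "N_bar N = (\<lambda>(a, b). (N [a, b] ! 0, N [a, b] ! 1))"

definition quadratic_normalisation :: "'a set \<Rightarrow> ('a list \<Rightarrow> 'a list) \<Rightarrow> bool" where
  "quadratic_normalisation A N \<longleftrightarrow>
     normalisation A N \<and>
     (\<forall>w\<in>lists A. normal_word N w \<longleftrightarrow>
        (\<forall>u a b v. w = u @ [a, b] @ v \<longrightarrow> normal_word N [a, b])) \<and>
     (\<forall>w\<in>lists A. \<exists>is. set is \<subseteq> {1..<length w} \<and> N w = fold (apply_at (N_bar N)) is w)"

text \<open>\<open>alternate f g m\<close> is the composite of $m$ maps that applies \<open>f\<close> first, then \<open>g\<close>, and so on.\<close>

fun alternate :: "('b \<Rightarrow> 'b) \<Rightarrow> ('b \<Rightarrow> 'b) \<Rightarrow> nat \<Rightarrow> 'b \<Rightarrow> 'b" where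
  "alternate f g 0 x = x"
| "alternate f g (Suc m) x = alternate g f m (f x)"

definition of_left_class :: "'a set \<Rightarrow> ('a list \<Rightarrow> 'a list) \<Rightarrow> nat \<Rightarrow> bool" where
  "of_left_class A N m \<longleftrightarrow>
     quadratic_normalisation A N \<and>
     (\<forall>w\<in>lists A. length w = 3 \<longrightarrow>
        N w = alternate (apply_at (N_bar N) 1) (apply_at (N_bar N) 2) m w)"

definition of_right_class :: "'a set \<Rightarrow> ('a list \<Rightarrow> 'a list) \<Rightarrow> nat \<Rightarrow> bool" where
  "of_right_class A N n \<longleftrightarrow>
     quadratic_normalisation A N \<and>
     (\<forall>w\<in>lists A. length w = 3 \<longrightarrow>
        N w = alternate (apply_at (N_bar N) 2) (apply_at (N_bar N) 1) n w)"

definition of_class :: "'a set \<Rightarrow> ('a list \<Rightarrow> 'a list) \<Rightarrow> nat \<times> nat \<Rightarrow> bool" where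
  "of_class A N = (\<lambda>(m, n). of_left_class A N m \<and> of_right_class A N n)"

end

(* Iterating eta gives every f a normal form, and recognition (stability of (a, h) depends only
   on the first letter of the normal form of h) shows that the normal forms are exactly the words
   whose adjacent pairs are all fixed by phi. Hence N'_phi w is the normal form of the product of
   w, padded with ones, and for the class it suffices that the alternating composites end in
   triples fixed by F1 and F2. If the composites in the factorability condition agree on a triple
   of letters, this follows from idempotence of F1 and F2; otherwise F2 F1 F2 reduces the total
   length to at most two, so its last entry is 1 and one more F1 gives a stable triple. *)

theory Submission
  imports Defs
begin

section \<open>Rewriting at positions of words\<close>

lemma apply_at_Cons_Suc: "1 \<le> i \<Longrightarrow> apply_at F (Suc i) (a # w) = a # apply_at F i w"
  by (cases i) (auto simp: apply_at_def split: prod.split)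

lemma apply_at_append: "i < length w \<Longrightarrow> apply_at F i (w @ u) = apply_at F i w @ u"
  by (auto simp: apply_at_def nth_append list_update_append split: prod.split)

lemma apply_at_one: "apply_at F 1 (a # b # w) = fst (F (a, b)) # snd (F (a, b)) # w"
  by (simp add: apply_at_def split: prod.split)

lemma apply_at_two:
  "apply_at F 2 (a # b # c # w) = a # fst (F (b, c)) # snd (F (b, c)) # w"
  by (simp add: apply_at_def numeral_2_eq_2 split: prod.split)

text \<open>Position 0 must be excluded: it does nothing to \<open>w\<close>, whereas its shift to 1
  would rewrite the head \<open>a\<close>.\<close>

lemma fold_apply_at_Cons:
  "set is \<subseteq> {1..<n} \<Longrightarrow>
     fold (apply_at F) (map Suc is) (a # w) = a # fold (apply_at F) is w"
  by (induction "is" arbitrary: w) (auto simp: apply_at_Cons_Suc)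

lemma fold_apply_at_append:
  "set is \<subseteq> {1..<length w} \<Longrightarrow>
     fold (apply_at F) is (w @ u) = fold (apply_at F) is w @ u"
  by (induction "is" arbitrary: w) (auto simp: apply_at_append)

lemma sweep_singleton [simp]: "sweep F [a] = [a]"
  by (simp add: sweep_def)

text \<open>Turns the fold over positions into a recursion on words: after position 1 the first
  letter is final, and the remaining positions sweep the tail.\<close>

lemma sweep_Cons_Cons:
  "sweep F (a # b # w) = fst (F (a, b)) # sweep F (snd (F (a, b)) # w)"
proof -
  have "[1..<length (a # b # w)] = 1 # map Suc [1..<length (b # w)]"
    by (simp add: upt_conv_Cons map_Suc_upt del: upt_Suc)
  then show ?thesis
    unfolding sweep_def
    using fold_apply_at_Cons[of "[1..<length (b # w)]" "length (b # w)"]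
    by (simp add: apply_at_one del: upt_Suc One_nat_def)
qed

section \<open>Reachability by finitely many rewriting steps\<close>

text \<open>The existence clause of \<open>quadratic_normalisation\<close>, isolated so that it can
  be chained and carried into longer words.\<close>

definition reaches :: "('a \<times> 'a \<Rightarrow> 'a \<times> 'a) \<Rightarrow> 'a list \<Rightarrow> 'a list \<Rightarrow> bool" where
  "reaches F w v \<longleftrightarrow> (\<exists>is. set is \<subseteq> {1..<length w} \<and> v = fold (apply_at F) is w)"

lemma reaches_refl: "reaches F w w"
  unfolding reaches_def by (rule exI[of _ "[]"]) simp

lemma reaches_trans:
  assumes "reaches F u v" "reaches F v w"
  shows "reaches F u w"
proof -
  obtain "is" js where "set is \<subseteq> {1..<length u}" "v = fold (apply_at F) is u"
    "set js \<subseteq> {1..<length v}" "w = fold (apply_at F) js v"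
    using assms by (auto simp: reaches_def)
  then show ?thesis
    unfolding reaches_def by (intro exI[of _ "is @ js"]) simp
qed

lemma reaches_Cons: "reaches F v w \<Longrightarrow> reaches F (a # v) (a # w)"
proof -
  assume "reaches F v w"
  then obtain "is" where "set is \<subseteq> {1..<length v}" "w = fold (apply_at F) is v"
    by (auto simp: reaches_def)
  then show ?thesis
    unfolding reaches_def
    by (intro exI[of _ "map Suc is"]) (auto simp: fold_apply_at_Cons)
qed

lemma reaches_append: "reaches F v w \<Longrightarrow> reaches F (v @ u) (w @ u)"
proof -
  assume "reaches F v w"
  then obtain "is" where "set is \<subseteq> {1..<length v}" "w = fold (apply_at F) is v"
    by (auto simp: reaches_def)
  then show ?thesis
    unfolding reaches_def
    by (intro exI[of _ "is"]) (auto simp: fold_apply_at_append)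
qed

lemma reaches_sweep: "reaches F w (sweep F w)"
  unfolding reaches_def sweep_def by (intro exI[of _ "[1..<length w]"]) simp

lemma reaches_length: "reaches F v w \<Longrightarrow> length w = length v"
  by (auto simp: reaches_def)

lemma prod_list_removeAll_one: "prod_list (removeAll 1 w) = prod_list (w :: 'a::monoid_mult list)"
  by (induction w) auto

section \<open>Lengths and factorisations\<close>

locale factorable =
  fixes S :: "'a::monoid_mult set" and \<eta> :: "'a \<Rightarrow> 'a \<times> 'a"
  assumes factorable: "factorable_monoid S \<eta>"
begin

abbreviation len :: "'a \<Rightarrow> nat" where
  "len \<equiv> word_length S"

abbreviation \<phi> :: "'a \<times> 'a \<Rightarrow> 'a \<times> 'a" where
  "\<phi> \<equiv> factor_prod \<eta>"

lemma phi_apply [simp]: "\<phi> (a, b) = \<eta> (a * b)"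
  by (simp add: factor_prod_def)

lemma one_in [simp]: "1 \<in> S"
  using factorable by (simp add: factorable_monoid_def)

lemma fact_map: "factorisation_map S \<eta>"
  using factorable by (simp add: factorable_monoid_def factorability_structure_def)

lemma eta_one [simp]: "\<eta> 1 = (1, 1)"
  using fact_map by (simp add: factorisation_map_def)

lemma eta_prod [simp]: "fst (\<eta> f) * snd (\<eta> f) = f"
  using fact_map unfolding factorisation_map_def by (metis eta_one fst_conv mult_1 snd_conv)

lemma eta_fst_in [simp]: "fst (\<eta> f) \<in> S"
  using fact_map unfolding factorisation_map_def by (metis DiffD1 eta_one fst_conv one_in)

lemma eta_fst_eq_one [simp]: "fst (\<eta> f) = 1 \<longleftrightarrow> f = 1"
  using fact_map unfolding factorisation_map_def by (metis DiffD2 eta_one fst_conv insertI1)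

lemma ex_len: "\<exists>w\<in>lists S. length w = len f \<and> prod_list w = f"
proof -
  obtain w where "w \<in> lists S" "prod_list w = f"
    using factorable by (auto simp: factorable_monoid_def generating_set_def)
  then have "\<exists>n. \<exists>w\<in>lists S. length w = n \<and> prod_list w = f" by blast
  then show ?thesis
    unfolding word_length_def by (rule LeastI_ex)
qed

lemma len_prod_list_le: "w \<in> lists S \<Longrightarrow> len (prod_list w) \<le> length w"
  unfolding word_length_def by (rule Least_le) blast

lemma len_eq_0_iff [simp]: "len f = 0 \<longleftrightarrow> f = 1"
proof
  show "len f = 0 \<Longrightarrow> f = 1" using ex_len[of f] by auto
  show "f = 1 \<Longrightarrow> len f = 0" using len_prod_list_le[of "[]"] by simp
qed

lemma len_one [simp]: "len 1 = 0"
  by simp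

lemma len_le_1_iff: "len f \<le> 1 \<longleftrightarrow> f \<in> S"
proof
  assume *: "len f \<le> 1"
  obtain w where w: "w \<in> lists S" "length w = len f" "prod_list w = f"
    using ex_len by blast
  show "f \<in> S"
  proof (cases w)
    case (Cons a v)
    then show ?thesis using w * by (cases v) auto
  qed (use w in auto)
qed (use len_prod_list_le[of "[f]"] in simp)

lemma len_letter: "a \<in> S \<Longrightarrow> len a = (if a = 1 then 0 else 1)"
  using len_le_1_iff[of a] len_eq_0_iff[of a] by (auto simp: le_Suc_eq simp del: len_eq_0_iff)

lemma len_eta_sum: "len (fst (\<eta> f)) + len (snd (\<eta> f)) = len f"
proof (cases "f = 1")
  case False
  then show ?thesis using fact_map unfolding factorisation_map_def by metis
qed simp

lemma len_eta: "f \<noteq> 1 \<Longrightarrow> len f = Suc (len (snd (\<eta> f)))"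
  using len_eta_sum[of f] len_letter[OF eta_fst_in, of f] by simp

lemma phi_eta [simp]: "\<phi> (\<eta> f) = \<eta> f"
  by (simp add: factor_prod_def case_prod_beta)

lemma eta_letter: "a \<in> S \<Longrightarrow> \<eta> a = (a, 1)"
proof (cases "a = 1")
  case False
  assume "a \<in> S"
  then have "snd (\<eta> a) = 1" using len_eta[OF False] len_letter[of a] False by simp
  then show ?thesis using eta_prod[of a] by (simp add: prod_eq_iff)
qed simp

text \<open>Makes \<open>\<phi>\<close> a map on pairs of letters: a product of two letters has
  length at most 2, and unless it is \<open>1\<close> its first factor takes up length 1.\<close>

lemma eta_snd_in: "a \<in> S \<Longrightarrow> b \<in> S \<Longrightarrow> snd (\<eta> (a * b)) \<in> S"
proof (cases "a * b = 1")
  case False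
  assume "a \<in> S" "b \<in> S"
  then have "len (a * b) \<le> 2" using len_prod_list_le[of "[a, b]"] by simp
  then show ?thesis using len_eta[OF False] len_le_1_iff by simp
qed simp

lemma factorability:
  fixes t defines "F1 \<equiv> apply_at \<phi> 1" and "F2 \<equiv> apply_at \<phi> 2"
  assumes "length t = 3"
  shows "(F1 (F2 (F1 (F2 t))) = F2 (F1 (F2 t)) \<and>
           F2 (F1 (F2 t)) = F2 (F1 (F2 (F1 t)))) \<or>
         (total_length S (F1 (F2 (F1 (F2 t)))) < total_length S t \<and>
          total_length S (F2 (F1 (F2 t))) < total_length S t \<and>
          total_length S (F2 (F1 (F2 (F1 t)))) < total_length S t)"
  using factorable assms(3)
  unfolding factorable_monoid_def factorability_structure_def Let_def F1_def F2_def
  by blast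

section \<open>Recognition of stable pairs\<close>

text \<open>
  Both directions compare the two ways of rewriting the triple $(1, a, h)$; the total length
  is preserved along one of them, which excludes the length-reducing alternative.
\<close>

lemma recognition:
  assumes "a \<in> S"
  shows "\<eta> (a * h) = (a, h) \<longleftrightarrow> \<eta> (a * fst (\<eta> h)) = (a, fst (\<eta> h))"
proof -
  let ?x = "fst (\<eta> (a * h))" and ?y = "snd (\<eta> (a * h))"
  let ?t = "fst (\<eta> h)" and ?g = "snd (\<eta> h)"
  let ?F1 = "apply_at \<phi> 1" and ?F2 = "apply_at \<phi> 2"
  have F2: "?F2 (?F1 (?F2 [1, a, h])) = [?x, fst (\<eta> ?y), snd (\<eta> ?y)]"
    by (simp add: apply_at_one apply_at_two eta_letter del: One_nat_def)
  have F1: "?F2 (?F1 [1, a, h]) = [a, ?t, ?g]"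
    using assms by (simp add: apply_at_one apply_at_two eta_letter del: One_nat_def)
  note alt = factorability[of "[1, a, h]", simplified, folded One_nat_def, unfolded F2 F1]
  show ?thesis
  proof
    \<comment> \<open>\<open>F2 F1 F2\<close> now yields \<open>[a, ?t, ?g]\<close>, as long in
      total as \<open>[1, a, h]\<close>; hence the composites agree and \<open>F1\<close> fixes this
      triple.\<close>
    assume *: "\<eta> (a * h) = (a, h)"
    then show "\<eta> (a * ?t) = (a, ?t)"
      using alt len_eta_sum[of h]
      by (auto simp: total_length_def apply_at_one prod_eq_iff simp del: One_nat_def)
  next
    assume *: "\<eta> (a * ?t) = (a, ?t)"
    \<comment> \<open>As \<open>F1\<close> fixes \<open>[a, ?t, ?g]\<close>, it is now
      \<open>F2 F1 F2 F1\<close> that keeps the total length, so its value equals that of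
      \<open>F2 F1 F2\<close>.\<close>
    have "[?x, fst (\<eta> ?y), snd (\<eta> ?y)] = [a, ?t, ?g]"
      using alt * len_eta_sum[of h]
      by (auto simp: total_length_def apply_at_one apply_at_two simp del: One_nat_def)
    then have "?x = a" "?y = h"
      using eta_prod[of ?y] eta_prod[of h] by auto
    then show "\<eta> (a * h) = (a, h)" by (simp add: prod_eq_iff)
  qed
qed

section \<open>Normal forms of elements\<close>

text \<open>Since \<open>\<eta> 1 = (1, 1)\<close>, \<open>nf n f\<close> is padded with ones once \<open>n\<close> exceeds the length of \<open>f\<close>.\<close>

primrec nf :: "nat \<Rightarrow> 'a \<Rightarrow> 'a list" where
  "nf 0 f = []"
| "nf (Suc n) f = fst (\<eta> f) # nf n (snd (\<eta> f))"

lemma length_nf [simp]: "length (nf n f) = n"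
  by (induction n arbitrary: f) auto

lemma nf_in_lists [simp]: "nf n f \<in> lists S"
  by (induction n arbitrary: f) auto

lemma nf_one [simp]: "nf n 1 = replicate n 1"
  by (induction n) auto

text \<open>After \<open>len f\<close> letters the remainder is \<open>1\<close>, from which
  \<open>\<eta>\<close> produces only ones.\<close>

lemma nf_add: "nf (len f + k) f = nf (len f) f @ replicate k 1"
proof (induction "len f" arbitrary: f)
  case 0
  then have "f = 1" by (metis len_eq_0_iff)
  then show ?case by simp
next
  case (Suc n)
  then have "f \<noteq> 1" by auto
  then have "len f = Suc (len (snd (\<eta> f)))" by (rule len_eta)
  then show ?case using Suc by simp
qed

lemma prod_list_nf: "len f \<le> n \<Longrightarrow> prod_list (nf n f) = f"
proof (induction n arbitrary: f)
  case (Suc n)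
  have "len (snd (\<eta> f)) \<le> n"
    using len_eta[of f] Suc.prems by (cases "f = 1") auto
  then show ?case using Suc.IH by simp
qed simp

text \<open>An adjacent pair has the form \<open>(fst (\<eta> f), fst (\<eta> h))\<close> with
  \<open>h = snd (\<eta> f)\<close>, where \<open>f\<close> is one of the successive remainders.
  Since \<open>(fst (\<eta> f), h)\<close> is stable, \<open>recognition\<close> makes this pair
  stable.\<close>

lemma nf_stable: "nf n f = u @ [a, b] @ v \<Longrightarrow> \<eta> (a * b) = (a, b)"
proof (induction n arbitrary: f u)
  case (Suc n)
  show ?case
  proof (cases u)
    case Nil
    let ?h = "snd (\<eta> f)"
    obtain m where "n = Suc m" using Suc.prems Nil by (cases n) auto
    then have "a = fst (\<eta> f)" "b = fst (\<eta> ?h)" using Suc.prems Nil by auto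
    then show ?thesis using recognition[of a ?h] by (simp add: prod_eq_iff)
  next
    case (Cons c u')
    then show ?thesis using Suc.IH[of "snd (\<eta> f)" u'] Suc.prems by simp
  qed
qed simp

text \<open>Converse of \<open>nf_stable\<close>, built from the right: once the tail is the normal
  form of its product \<open>h\<close>, stability of \<open>a\<close> with the first letter of the
  tail lifts by \<open>recognition\<close> to stability of \<open>(a, h)\<close>, so
  \<open>\<eta>\<close> splits off \<open>a\<close>.\<close>

lemma stable_imp_nf:
  assumes "w \<in> lists S" "\<And>u a b v. w = u @ [a, b] @ v \<Longrightarrow> \<eta> (a * b) = (a, b)"
  shows "w = nf (length w) (prod_list w)"
  using assms
proof (induction w rule: list.induct)
  case (Cons a w)
  have *: "w = nf (length w) (prod_list w)"
    using Cons.prems(2)[of "a # _"] Cons.prems(1) by (intro Cons.IH) auto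
  have "\<eta> (a * prod_list w) = (a, prod_list w)"
  proof (cases w)
    case Nil
    then show ?thesis using Cons.prems by (simp add: eta_letter)
  next
    case w: (Cons b w')
    then have "b = fst (\<eta> (prod_list w))" using * by simp
    moreover have "\<eta> (a * b) = (a, b)" using Cons.prems(2)[of "[]"] w by simp
    ultimately show ?thesis using recognition[of a "prod_list w"] Cons.prems by simp
  qed
  then show ?case using * by simp
qed simp

section \<open>Sweeping and \<open>N_phi\<close> compute normal forms\<close>

lemma prod_list_sweep: "prod_list (sweep \<phi> (a # w)) = a * prod_list w"
proof (induction w arbitrary: a)
  case (Cons b w)
  then show ?case by (simp add: sweep_Cons_Cons mult.assoc[symmetric])
qed simp

lemma sweep_in_lists: "w \<in> lists S \<Longrightarrow> a \<in> S \<Longrightarrow> sweep \<phi> (a # w) \<in> lists S"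
  by (induction w arbitrary: a) (auto simp: sweep_Cons_Cons eta_snd_in)

text \<open>\<open>\<phi>\<close> sends \<open>(1, b)\<close> to \<open>(b, 1)\<close>, so the
  \<open>1\<close> travels to the end.\<close>

lemma sweep_one: "w \<in> lists S \<Longrightarrow> sweep \<phi> (1 # w) = w @ [1]"
  by (induction w) (auto simp: sweep_Cons_Cons eta_letter)

text \<open>Induction on \<open>len f\<close>. Without a \<open>1\<close> in the result no length is
  lost, which forces the equality case of factorability on \<open>[s, t, g]\<close>, where
  \<open>f = t * g\<close>. The stability so obtained extends to the whole product by
  \<open>recognition\<close>.\<close>

lemma sweep_nf:
  assumes "s \<in> S" "s \<noteq> 1" "1 \<notin> set (sweep \<phi> (s # nf (len f) f))"
  shows "len (s * f) = Suc (len f)"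
    and "sweep \<phi> (s # nf (len f) f) = nf (len (s * f)) (s * f)"
proof -
  have "len (s * f) = Suc (len f) \<and>
    sweep \<phi> (s # nf (len f) f) = nf (len (s * f)) (s * f)"
    using assms
  proof (induction "len f" arbitrary: f s)
    case 0
    then have "f = 1" by (metis len_eq_0_iff)
    then show ?case using 0 by (simp add: eta_letter len_letter)
  next
    case (Suc n)
    define t g where "t = fst (\<eta> f)" and "g = snd (\<eta> f)"
    have f: "f = t * g" "t \<in> S" by (simp_all add: t_def g_def)
    have "f \<noteq> 1" using Suc.hyps by auto
    then have lf: "len f = Suc (len g)" "t \<noteq> 1" using len_eta by (auto simp: g_def t_def)
    then have nff: "nf (len f) f = t # nf (len g) g" by (simp add: t_def g_def)
    define a b where "a = fst (\<eta> (s * t))" and "b = snd (\<eta> (s * t))"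
    have ab: "a \<in> S" "b \<in> S" "s * t = a * b"
      using Suc.prems f by (simp_all add: a_def b_def eta_snd_in)
    have sw: "sweep \<phi> (s # nf (len f) f) = a # sweep \<phi> (b # nf (len g) g)"
      by (simp add: nff sweep_Cons_Cons a_def b_def)
    then have no: "a \<noteq> 1" "1 \<notin> set (sweep \<phi> (b # nf (len g) g))" using Suc.prems by auto
    \<comment> \<open>By \<open>sweep_one\<close>, \<open>b = 1\<close> would leave a
      \<open>1\<close> at the end of the sweep.\<close>
    then have "b \<noteq> 1" by (auto simp: sweep_one)
    then have IH: "len (b * g) = Suc (len g)"
      "sweep \<phi> (b # nf (len g) g) = nf (len (b * g)) (b * g)"
      using Suc.hyps(1)[of g b] ab no Suc.hyps(2) lf by auto
    let ?F1 = "apply_at \<phi> 1" and ?F2 = "apply_at \<phi> 2"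
    have F2: "?F2 [s, t, g] = [s, t, g]"
      using f by (simp add: apply_at_two t_def g_def)
    have F21: "?F2 (?F1 [s, t, g]) = [a, fst (\<eta> (b * g)), snd (\<eta> (b * g))]"
      by (simp add: apply_at_one apply_at_two a_def b_def del: One_nat_def)
    \<comment> \<open>Both totals are \<open>len g + 2\<close>, by the induction hypothesis on
      \<open>b * g\<close>; this excludes the reducing alternative.\<close>
    have "total_length S (?F2 (?F1 (?F2 [s, t, g]))) = total_length S [s, t, g]"
      using len_eta_sum[of "b * g"] IH Suc.prems no ab lf f
      unfolding F2 F21 by (simp add: total_length_def len_letter)
    then have "?F1 (?F2 (?F1 [s, t, g])) = ?F2 (?F1 [s, t, g])"
      using factorability[of "[s, t, g]"] by (simp add: F2 del: One_nat_def)
    then have "\<eta> (a * fst (\<eta> (b * g))) = (a, fst (\<eta> (b * g)))"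
      unfolding F21 by (auto simp: apply_at_one prod_eq_iff simp del: One_nat_def)
    then have "\<eta> (a * (b * g)) = (a, b * g)" using recognition[OF ab(1)] by blast
    moreover have "s * f = a * (b * g)" using ab f by (metis mult.assoc)
    ultimately have e: "\<eta> (s * f) = (a, b * g)" by simp
    then have "s * f \<noteq> 1" using no by auto
    then have "len (s * f) = Suc (len (b * g))" using e len_eta by simp
    then show ?case using e IH sw lf by simp
  qed
  then show "len (s * f) = Suc (len f)"
    and "sweep \<phi> (s # nf (len f) f) = nf (len (s * f)) (s * f)" by auto
qed

text \<open>Follows the recursion of \<open>N_phi\<close>: deleting ones and sweeping keep the
  product, so every recursive call already has the right value, and a sweep without \<open>1\<close>
  is the normal form by \<open>sweep_nf\<close>.\<close>

lemma N_phi_eq_nf: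
  "w \<in> lists S \<Longrightarrow> N_phi \<phi> w = nf (len (prod_list w)) (prod_list w)"
proof (induction "\<phi>" w rule: N_phi.induct)
  case 1
  then show ?case by simp
next
  case (2 s w)
  show ?case
  proof (cases "1 \<in> set (s # w)")
    case True
    have "removeAll 1 (s # w) \<in> lists S" using 2(4) by auto
    with 2(1)[OF True] True show ?thesis
      using prod_list_removeAll_one[of "s # w"] by (simp del: removeAll.simps)
  next
    case False
    define f where "f = prod_list w"
    define v where "v = sweep \<phi> (s # N_phi \<phi> w)"
    have IH: "N_phi \<phi> w = nf (len f) f" using 2(2)[OF False] 2(4) by (simp add: f_def)
    have v: "v = sweep \<phi> (s # nf (len f) f)" by (simp add: v_def IH)
    have vS: "v \<in> lists S" using 2(4) by (simp add: v sweep_in_lists)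
    have vp: "prod_list v = s * f" by (simp add: v prod_list_sweep prod_list_nf)
    have N: "N_phi \<phi> (s # w) = (if 1 \<in> set v then N_phi \<phi> v else v)"
      using False by (simp add: v_def Let_def)
    show ?thesis
    proof (cases "1 \<in> set v")
      case True
      then show ?thesis using N 2(3)[OF False v_def True vS] vp by (simp add: f_def)
    next
      case no: False
      then show ?thesis
        using N sweep_nf(2)[of s f] 2(4) False by (simp add: v f_def)
    qed
  qed
qed

section \<open>\<open>N'_phi\<close> and rewriting of words over \<open>S\<close>\<close>

text \<open>The ones appended by \<open>N'_phi\<close> are those that \<open>nf\<close> produces
  beyond the length of the product.\<close>

lemma N'_phi_eq_nf:
  assumes "w \<in> lists S"
  shows "N'_phi \<phi> w = nf (length w) (prod_list w)"
  using nf_add[of "prod_list w" "length w - len (prod_list w)"] len_prod_list_le[OF assms]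
  by (simp add: N'_phi_def N_phi_eq_nf[OF assms])

text \<open>Allows \<open>\<phi>\<close> to replace \<open>N_bar\<close> on words over
  \<open>S\<close>. The remainder of \<open>a * b\<close> is a letter, so the next step of
  \<open>nf\<close> returns it unchanged.\<close>

lemma N_bar_eq: "a \<in> S \<Longrightarrow> b \<in> S \<Longrightarrow> N_bar (N'_phi \<phi>) (a, b) = \<eta> (a * b)"
  by (simp add: N_bar_def N'_phi_eq_nf eta_letter eta_snd_in)

lemma normal_pair_iff:
  "a \<in> S \<Longrightarrow> b \<in> S \<Longrightarrow> normal_word (N'_phi \<phi>) [a, b] \<longleftrightarrow> \<eta> (a * b) = (a, b)"
  by (simp add: normal_word_def N'_phi_eq_nf eta_letter eta_snd_in prod_eq_iff)

lemma apply_at_N_bar: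
  assumes "w \<in> lists S"
  shows "apply_at (N_bar (N'_phi \<phi>)) i w = apply_at \<phi> i w"
proof (cases "1 \<le> i \<and> i < length w")
  case True
  then have "w ! (i - 1) \<in> S" "w ! i \<in> S" 
    using assms nth_mem[of "i - 1" w] nth_mem[of i w] by auto
  then show ?thesis by (simp add: apply_at_def N_bar_eq)
qed (auto simp: apply_at_def)

lemma apply_at_in_lists:
  assumes "w \<in> lists S"
  shows "apply_at \<phi> i w \<in> lists S"
proof (cases "1 \<le> i \<and> i < length w")
  case True
  then have "w ! (i - 1) \<in> S" "w ! i \<in> S" 
    using assms nth_mem[of "i - 1" w] nth_mem[of i w] by auto
  then show ?thesis using assms
    by (simp add: apply_at_def case_prod_beta lists_eq_set set_update_subsetI eta_snd_in)
qed (use assms in \<open>auto simp: apply_at_def\<close>)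

lemma fold_apply_at_in_lists: "w \<in> lists S \<Longrightarrow> fold (apply_at \<phi>) is w \<in> lists S"
  by (induction "is" arbitrary: w) (auto simp: apply_at_in_lists)

lemma fold_apply_at_N_bar:
  "w \<in> lists S \<Longrightarrow> fold (apply_at (N_bar (N'_phi \<phi>))) is w = fold (apply_at \<phi>) is w"
  by (induction "is" arbitrary: w)
    (auto simp: apply_at_N_bar apply_at_in_lists)

lemma prod_list_apply_at: "prod_list (apply_at \<phi> i w) = prod_list w"
proof (induction w arbitrary: i)
  case Nil
  then show ?case by (simp add: apply_at_def)
next
  case (Cons a w)
  consider "i = 0" | "i = 1" | j where "i = Suc j" "1 \<le> j"
    by (metis One_nat_def less_one not_less old.nat.exhaust)
  then show ?case
  proof cases
    case 1
    then show ?thesis by (simp add: apply_at_def)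
  next
    case 2
    then show ?thesis
      by (cases w) (auto simp: apply_at_one mult.assoc[symmetric] apply_at_def[of _ _ "[a]"]
          simp del: One_nat_def)
  next
    case 3
    then show ?thesis using Cons by (simp add: apply_at_Cons_Suc)
  qed
qed

lemma prod_list_fold_apply_at: "prod_list (fold (apply_at \<phi>) is w) = prod_list w"
  by (induction "is" arbitrary: w) (auto simp: prod_list_apply_at)

section \<open>Reaching the normal form by rewriting\<close>

lemma reaches_in_lists: "w \<in> lists S \<Longrightarrow> reaches \<phi> w v \<Longrightarrow> v \<in> lists S"
  unfolding reaches_def using fold_apply_at_in_lists by blast

lemma reaches_prod_list: "reaches \<phi> w v \<Longrightarrow> prod_list v = prod_list w"
  by (auto simp: reaches_def prod_list_fold_apply_at)

text \<open>A sweep that starts at an occurrence of \<open>1\<close> carries it to the end.\<close>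

lemma reaches_one_last:
  "w \<in> lists S \<Longrightarrow> 1 \<in> set w \<Longrightarrow> \<exists>u. reaches \<phi> w (u @ [1])"
proof (induction w)
  case (Cons a w)
  have "\<exists>u. reaches \<phi> (1 # v) (u @ [1])" if "v \<in> lists S" for v
    using reaches_sweep[of \<phi> "1 # v"] sweep_one[OF that] by auto
  moreover have "\<exists>u. reaches \<phi> (a # w) (u @ [1])" if w1: "1 \<in> set w"
  proof -
    obtain u where "reaches \<phi> w (u @ [1])" using Cons.IH Cons.prems(1) w1 by auto
    then have "reaches \<phi> (a # w) ((a # u) @ [1])" by (simp add: reaches_Cons)
    then show ?thesis by blast
  qed
  ultimately show ?case using Cons.prems by auto
qed simp

text \<open>Induction on the length: normalise the tail, then sweep the first letter through it. If
  no \<open>1\<close> turns up, \<open>sweep_nf\<close> applies; otherwise a \<open>1\<close> moves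
  to the end and leaves a shorter word to normalise.\<close>

lemma reaches_nf: "w \<in> lists S \<Longrightarrow> reaches \<phi> w (nf (length w) (prod_list w))"
proof (induction "length w" arbitrary: w)
  case 0
  then show ?case by (simp add: reaches_refl)
next
  case (Suc n)
  have via_one: "reaches \<phi> w (nf (length w) (prod_list w))"
    if wx: "reaches \<phi> w x" and x1: "1 \<in> set x" for x
  proof -
    have "x \<in> lists S" using reaches_in_lists Suc.prems wx by blast
    then obtain u where u: "reaches \<phi> x (u @ [1])" using reaches_one_last x1 by blast
    then have wu: "reaches \<phi> w (u @ [1])" using wx reaches_trans by blast
    have uS: "u \<in> lists S" using reaches_in_lists[OF Suc.prems wu] by simp
    have lu: "length w = Suc (length u)" and pu: "prod_list w = prod_list u"
      using reaches_length[OF wu] reaches_prod_list[OF wu] by simp_all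
    have "reaches \<phi> (u @ [1]) (nf (length u) (prod_list u) @ [1])"
      using Suc.hyps lu uS by (intro reaches_append) simp
    \<comment> \<open>The product has length at most \<open>length u\<close>, so both sides are its
      normal form with the same padding.\<close>
    moreover have "nf (length u) (prod_list u) @ [1] = nf (length w) (prod_list w)"
      using nf_add[of "prod_list u" "length u - len (prod_list u)"]
        nf_add[of "prod_list u" "Suc (length u - len (prod_list u))"]
        len_prod_list_le[OF uS] by (simp add: lu pu replicate_append_same)
    ultimately show ?thesis using reaches_trans[OF wu] by simp
  qed
  obtain s w' where w: "w = s # w'" using Suc.hyps by (cases w) auto
  let ?x = "s # nf (length w') (prod_list w')"
  have wx: "reaches \<phi> w ?x" using Suc w by (auto intro!: reaches_Cons)
  let ?v = "sweep \<phi> ?x"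
  have wv: "reaches \<phi> w ?v" using reaches_trans[OF wx reaches_sweep] .
  show ?case
  proof (cases "1 \<in> set ?x \<or> 1 \<in> set ?v")
    case True
    then show ?thesis using via_one wx wv by blast
  next
    case False
    define k where "k = length w' - len (prod_list w')"
    have lw: "length w' = len (prod_list w') + k"
      using len_prod_list_le[of w'] Suc.prems by (simp add: k_def w)
    then have "nf (length w') (prod_list w')
        = nf (len (prod_list w')) (prod_list w') @ replicate k 1"
      by (simp only: nf_add)
    \<comment> \<open>Any padding would put a \<open>1\<close> into \<open>?x\<close>.\<close>
    then have "k = 0" using False by (cases k) simp_all
    then have "?v = nf (length w) (prod_list w)"
      using sweep_nf[of s "prod_list w'"] False Suc.prems lw by (simp add: w)
    then show ?thesis using wv by simp
  qed
qed

section \<open>The quadratic normalisation\<close>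

text \<open>\<open>N'_phi\<close> depends only on the length and the product of a word, and both
  survive the replacement of \<open>v\<close> by \<open>N'_phi \<phi> v\<close>.\<close>

lemma normalisation_N'_phi: "normalisation S (N'_phi \<phi>)"
  unfolding normalisation_def
proof (intro conjI ballI)
  fix w assume "w \<in> lists S"
  then show "N'_phi \<phi> w \<in> lists S" "length (N'_phi \<phi> w) = length w"
    by (simp_all add: N'_phi_eq_nf)
next
  fix a assume "a \<in> S"
  then show "N'_phi \<phi> [a] = [a]" by (simp add: N'_phi_eq_nf eta_letter)
next
  fix u v w assume uvw: "u \<in> lists S" "v \<in> lists S" "w \<in> lists S"
  then have v: "N'_phi \<phi> v = nf (length v) (prod_list v)" by (simp add: N'_phi_eq_nf)
  have "u @ v @ w \<in> lists S" "u @ N'_phi \<phi> v @ w \<in> lists S"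
    using uvw nf_in_lists unfolding v by auto
  then show "N'_phi \<phi> (u @ v @ w) = N'_phi \<phi> (u @ N'_phi \<phi> v @ w)"
    using uvw by (simp add: N'_phi_eq_nf v prod_list_nf len_prod_list_le)
qed

text \<open>Normality is local by \<open>nf_stable\<close> and \<open>stable_imp_nf\<close>; the
  positions come from \<open>reaches_nf\<close>.\<close>

lemma quadratic_N'_phi: "quadratic_normalisation S (N'_phi \<phi>)"
  unfolding quadratic_normalisation_def
proof (intro conjI ballI normalisation_N'_phi)
  fix w assume w: "w \<in> lists S"
  show "normal_word (N'_phi \<phi>) w \<longleftrightarrow>
    (\<forall>u a b v. w = u @ [a, b] @ v \<longrightarrow> normal_word (N'_phi \<phi>) [a, b])" (is "_ \<longleftrightarrow> ?R")
  proof
    assume "normal_word (N'_phi \<phi>) w"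
    then have "nf (length w) (prod_list w) = w"
      using w by (simp add: normal_word_def N'_phi_eq_nf)
    then show ?R
      using w nf_stable[of "length w" "prod_list w"] by (auto simp: normal_pair_iff)
  next
    assume R: ?R
    have "w = nf (length w) (prod_list w)"
    proof (rule stable_imp_nf[OF w])
      fix u a b v assume "w = u @ [a, b] @ v"
      then show "\<eta> (a * b) = (a, b)" using R w normal_pair_iff[of a b] by auto
    qed
    then show "normal_word (N'_phi \<phi>) w"
      using w by (simp add: normal_word_def N'_phi_eq_nf)
  qed
  show "\<exists>is. set is \<subseteq> {1..<length w} \<and> N'_phi \<phi> w = fold (apply_at (N_bar (N'_phi \<phi>))) is w"
    using reaches_nf[OF w] by (simp add: reaches_def N'_phi_eq_nf[OF w] fold_apply_at_N_bar[OF w])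
qed

section \<open>Words of length three and the class\<close>

lemma nf_triple:
  assumes "t \<in> lists S" "length t = 3" "apply_at \<phi> 1 t = t" "apply_at \<phi> 2 t = t"
  shows "t = nf 3 (prod_list t)"
proof -
  obtain a b c where t: "t = [a, b, c]"
    using assms(2) by (auto simp: numeral_3_eq_3 length_Suc_conv)
  have "\<eta> (a * b) = (a, b)" "\<eta> (b * c) = (b, c)"
    using assms(3,4) by (simp_all add: t apply_at_one apply_at_two prod_eq_iff del: One_nat_def)
  then have "t = nf (length t) (prod_list t)"
    using assms(1) by (intro stable_imp_nf) (auto simp: t Cons_eq_append_conv)
  then show ?thesis by (simp only: assms(2))
qed

lemma apply_at_idem:
  "length t = 3 \<Longrightarrow> i \<in> {1, 2} \<Longrightarrow> apply_at \<phi> i (apply_at \<phi> i t) = apply_at \<phi> i t"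
  by (auto simp: numeral_3_eq_3 length_Suc_conv apply_at_one apply_at_two simp del: One_nat_def)

text \<open>The last entry of \<open>F2 (F1 t)\<close> is \<open>1\<close>: a \<open>1\<close> in an
  earlier entry forces this, and otherwise the length bound does. The next \<open>F1\<close> leaves
  that entry alone, and \<open>F2\<close> fixes a letter followed by \<open>1\<close>.\<close>

lemma short_triple_stable:
  fixes t defines "F1 \<equiv> apply_at \<phi> 1" and "F2 \<equiv> apply_at \<phi> 2"
  assumes t: "t \<in> lists S" "length t = 3" and short: "total_length S (F2 (F1 t)) \<le> 2"
  shows "F2 (F1 (F2 (F1 t))) = F1 (F2 (F1 t))"
proof -
  obtain a b c where abc: "t = [a, b, c]" "a \<in> S" "b \<in> S" "c \<in> S"
    using t by (auto simp: numeral_3_eq_3 length_Suc_conv)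
  define x p where "x = fst (\<eta> (a * b))" and "p = snd (\<eta> (a * b))"
  define y z where "y = fst (\<eta> (p * c))" and "z = snd (\<eta> (p * c))"
  have S: "x \<in> S" "p \<in> S" "y \<in> S" "z \<in> S"
    using abc by (simp_all add: x_def p_def y_def z_def eta_snd_in)
  have e: "F2 (F1 t) = [x, y, z]"
    by (simp add: F1_def F2_def abc apply_at_one apply_at_two x_def y_def p_def z_def
        del: One_nat_def)
  have "z = 1"
  proof (cases "x = 1")
    case True
    then have "p = 1" by (simp add: x_def p_def)
    then show ?thesis using abc by (simp add: z_def eta_letter)
  next
    case False
    moreover have "z = 1" if "y = 1" using that by (simp add: y_def z_def)
    ultimately show ?thesis
      using short S unfolding e by (auto simp: total_length_def len_letter split: if_splits)
  qed
  then show ?thesis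
    unfolding e using S
    by (simp add: F1_def F2_def apply_at_one apply_at_two eta_letter eta_snd_in del: One_nat_def)
qed

text \<open>Both composites end in \<open>F1\<close>, so \<open>F1\<close> fixes their values by
  idempotence; what remains is that \<open>F2\<close> fixes them.\<close>

lemma four_steps:
  fixes t defines "F1 \<equiv> apply_at \<phi> 1" and "F2 \<equiv> apply_at \<phi> 2"
  assumes t: "t \<in> lists S" "length t = 3"
  shows "F1 (F2 (F1 (F2 t))) = nf 3 (prod_list t)"
    and "F1 (F2 (F1 (F2 (F1 t)))) = nf 3 (prod_list t)"
proof -
  have idem: "F1 (F1 u) = F1 u" "F2 (F2 u) = F2 u" if "length u = 3" for u
    using apply_at_idem[OF that] by (simp_all add: F1_def F2_def del: One_nat_def)
  have len3: "length (F1 u) = length u" "length (F2 u) = length u" for u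
    by (simp_all add: F1_def F2_def)
  have S: "F1 u \<in> lists S" "F2 u \<in> lists S" if "u \<in> lists S" for u
    using that apply_at_in_lists unfolding F1_def F2_def by blast+
  have prod: "prod_list (F1 u) = prod_list u" "prod_list (F2 u) = prod_list u" for u
    by (simp_all add: F1_def F2_def prod_list_apply_at)
  have nf: "u = nf 3 (prod_list t)"
    if "u \<in> lists S" "length u = 3" "F1 u = u" "F2 u = u" "prod_list u = prod_list t" for u
    using nf_triple[of u] that by (simp add: F1_def F2_def del: One_nat_def)
  have total: "total_length S t \<le> 3"
    using t by (auto simp: numeral_3_eq_3 length_Suc_conv total_length_def len_letter)
  have short: "F2 (F1 (F2 (F1 u))) = F1 (F2 (F1 u))"
    if "u \<in> lists S" "length u = 3" "total_length S (F2 (F1 u)) \<le> 2" for u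
    using short_triple_stable[of u] that by (simp add: F1_def F2_def del: One_nat_def)
  have fact: "(F1 (F2 (F1 (F2 t))) = F2 (F1 (F2 t)) \<and> F2 (F1 (F2 t)) = F2 (F1 (F2 (F1 t)))) \<or>
    (total_length S (F2 (F1 (F2 t))) \<le> 2 \<and> total_length S (F2 (F1 (F2 (F1 t)))) \<le> 2)"
    using factorability[OF t(2)] total unfolding F1_def F2_def by linarith
  have stable: "F2 (F1 (F2 (F1 (F2 t)))) = F1 (F2 (F1 (F2 t))) \<and>
    F2 (F1 (F2 (F1 (F2 (F1 t))))) = F1 (F2 (F1 (F2 (F1 t))))"
    using fact
  proof
    assume "F1 (F2 (F1 (F2 t))) = F2 (F1 (F2 t)) \<and> F2 (F1 (F2 t)) = F2 (F1 (F2 (F1 t)))"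
    \<comment> \<open>The common value is fixed by \<open>F1\<close>, and by \<open>F2\<close> since
      \<open>F2\<close> was applied last.\<close>
    then show ?thesis using idem t by (metis len3)
  next
    assume "total_length S (F2 (F1 (F2 t))) \<le> 2 \<and> total_length S (F2 (F1 (F2 (F1 t)))) \<le> 2"
    then show ?thesis
      \<comment> \<open>These arguments are what the last three maps \<open>F1 F2 F1\<close> of the
        two composites act on.\<close>
      using short[of "F2 t"] short[of "F2 (F1 t)"] S t len3 by metis
  qed
  show "F1 (F2 (F1 (F2 t))) = nf 3 (prod_list t)"
    by (rule nf) (use stable t in \<open>simp_all only: S prod len3 idem\<close>)
  show "F1 (F2 (F1 (F2 (F1 t)))) = nf 3 (prod_list t)"
    by (rule nf) (use stable t in \<open>simp_all only: S prod len3 idem\<close>)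
qed

text \<open>The right class counts the maps of \<open>F1 F2 F1 F2\<close>; the left class counts the
  same four preceded by an \<open>F1\<close>.\<close>

lemma class_N'_phi: "of_class S (N'_phi \<phi>) (5, 4)"
proof -
  let ?G = "apply_at (N_bar (N'_phi \<phi>))"
  have "N'_phi \<phi> w = alternate (?G 1) (?G 2) 5 w \<and> N'_phi \<phi> w = alternate (?G 2) (?G 1) 4 w"
    if "w \<in> lists S" "length w = 3" for w
    using that four_steps[OF that]
    by (simp add: eval_nat_numeral apply_at_N_bar apply_at_in_lists N'_phi_eq_nf)
  then show ?thesis
    using quadratic_N'_phi
    unfolding of_class_def of_left_class_def of_right_class_def prod.case by blast
qed

end

theorem lemma4p1p6:
  fixes S :: "'a::monoid_mult set" and \<eta> :: "'a \<Rightarrow> 'a \<times> 'a"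
  assumes "factorable_monoid S \<eta>"
  shows "of_class S (N'_phi (factor_prod \<eta>)) (5, 4)"
proof -
  interpret factorable S \<eta> using assms by unfold_locales
  show ?thesis by (rule class_N'_phi)
qed

end
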